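(* Let $T$ be a quadratic starlike tree containing $K_{1,3}$ as a proper induced subgraph, with characteristic polynomial $f_T(x)=\det(xI-A(T))$. Then $f_T(x)$ is of the form $$f_T(x)=x^{t_1}(x^2-1)^{t_2}(x^2-2)^{t_3}\big((x^2-x-1)(x^2+x-1)\big)^{t_4}(x^2-3)^{t_5}(x^2-c),$$ with integers $t_1,\dots,t_5\ge 0$, an integer $c\ge 4$, and $\lambda_1(T)$ a root of $x^2-c$ (form (I)), if and only if $T$ is one of the following four graphs; in each case the characteristic polynomial is as stated: (1) $T_{1,1,0,0,n_5}$ with $n_5\ge 1$, and $f_T(x)=x^{n_5}(x^2-1)^{n_5}(x^2-x-1)(x^2+x-1)(x^2-3)^{n_5-1}(x^2-(n_5+3))$; (2) $T_{1,0,n_3}$ with $n_3\ge 2$, and $f_T(x)=x^{n_3}(x^2-1)(x^2-2)^{n_3-1}(x^2-(n_3+2))$; (3) $T_{0,n_2}$ with $n_2\ge 3$, and $f_T(x)=x(x^2-1)^{n_2-1}(x^2-(n_2+1))$; (4) $T_{n_1}$ (the star $K_{1,n_1}$) with $n_1\ge 4$, and $f_T(x)=x^{n_1-1}(x^2-n_1)$.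
   Context: All graphs are simple and connected; eigenvalues are those of the adjacency matrix $A(G)$, ordered $\lambda_1(G)\ge\lambda_2(G)\ge\cdots$. A graph is quadratic if every eigenvalue is an algebraic integer of degree at most $2$, equivalently every irreducible factor over $\mathbb{Q}$ of its characteristic polynomial has degree at most $2$. $P_i$ denotes the path on $i$ vertices. The starlike tree $T_{n_1,n_2,\ldots,n_k}$ is the tree on $n_1+2n_2+\cdots+kn_k+1$ vertices consisting of a center vertex $u$ together with $n_i$ pendant paths $P_i$ (each joined by an edge from one endpoint to $u$), i.e. $T-u=\bigcup_{i=1}^k n_iP_i$; trailing zero indices may be omitted. *)

theory Defs
  imports
    "Graph_Theory.Graph_Theory"
    "Jordan_Normal_Form.Char_Poly"
    "Jordan_Normal_Form.Spectral_Radius"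
begin

text \<open>A finite simple graph is a symmetric irreflexive digraph on pairs
  (locale \<^locale>\<open>pair_graph\<close>): an edge \<open>uv\<close> is the pair of arcs \<open>(u,v)\<close>, \<open>(v,u)\<close>.\<close>

definition adjacency_matrix_wrt ::
  "'a list \<Rightarrow> 'a pair_pre_digraph \<Rightarrow> 'b :: {zero, one} mat" where
  "adjacency_matrix_wrt vs G =
     mat (length vs) (length vs) (\<lambda>(i, j). if (vs ! i, vs ! j) \<in> parcs G then 1 else 0)"

text \<open>\<open>A(G)\<close> is taken for some enumeration of the vertices; by
  \<open>char_poly_adjacency_matrix_eq\<close> below the choice does not affect the characteristic
  polynomial, hence not the eigenvalues.\<close>

definition adjacency_matrix :: "'a pair_pre_digraph \<Rightarrow> 'b :: {zero, one} mat" where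
  "adjacency_matrix G =
     adjacency_matrix_wrt (SOME vs. distinct vs \<and> set vs = pverts G) G"

definition graph_char_poly :: "'a pair_pre_digraph \<Rightarrow> int poly" where
  "graph_char_poly G = char_poly (adjacency_matrix G)"

text \<open>For a graph \<open>A(G)\<close> is symmetric, so its real eigenvalues are all its eigenvalues.\<close>

definition graph_eigenvalues :: "'a pair_pre_digraph \<Rightarrow> real set" where
  "graph_eigenvalues G = spectrum (adjacency_matrix G)"

definition lambda1 :: "'a pair_pre_digraph \<Rightarrow> real" where
  "lambda1 G = Max (graph_eigenvalues G)"

text \<open>The degree of an algebraic number: that of its minimal polynomial over the rationals.
  Only meaningful for algebraic \<open>x\<close>.\<close>

definition alg_degree :: "'a :: field_char_0 \<Rightarrow> nat" where
  "alg_degree x =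
     (LEAST d. \<exists>p :: rat poly. p \<noteq> 0 \<and> degree p = d \<and> poly (map_poly of_rat p) x = 0)"

definition quadratic_graph :: "'a pair_pre_digraph \<Rightarrow> bool" where
  "quadratic_graph G \<longleftrightarrow> (\<forall>x \<in> graph_eigenvalues G. algebraic_int x \<and> alg_degree x \<le> 2)"

text \<open>\<open>Leg i j l\<close> is the \<open>l\<close>-th vertex (counted from the centre, starting at 1) of the \<open>j\<close>-th
  (starting at 0) pendant path with \<open>i\<close> vertices. The list \<open>ns\<close> is \<open>[n\<^sub>1, \<dots>, n\<^sub>k]\<close>, so that
  \<open>n\<^sub>i\<close> is \<open>ns ! (i - 1)\<close>.\<close>

datatype starlike_vertex = Centre | Leg nat nat nat

definition starlike_edges :: "nat list \<Rightarrow> (starlike_vertex \<times> starlike_vertex) set" where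
  "starlike_edges ns =
     {(Centre, Leg i j 1) | i j. 1 \<le> i \<and> i \<le> length ns \<and> j < ns ! (i - 1)} \<union>
     {(Leg i j l, Leg i j (l + 1)) | i j l.
        1 \<le> i \<and> i \<le> length ns \<and> j < ns ! (i - 1) \<and> 1 \<le> l \<and> l < i}"

definition starlike_tree :: "nat list \<Rightarrow> starlike_vertex pair_pre_digraph" where
  "starlike_tree ns =
     \<lparr> pverts = insert Centre {Leg i j l | i j l.
         1 \<le> i \<and> i \<le> length ns \<and> j < ns ! (i - 1) \<and> 1 \<le> l \<and> l \<le> i},
       parcs = starlike_edges ns \<union> (starlike_edges ns)\<inverse> \<rparr>"

definition is_starlike :: "'a pair_pre_digraph \<Rightarrow> nat list \<Rightarrow> bool" where
  "is_starlike G ns \<longleftrightarrow> digraph_iso (with_proj G) (with_proj (starlike_tree ns))"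

definition has_proper_induced_K13 :: "'a pair_pre_digraph \<Rightarrow> bool" where
  "has_proper_induced_K13 G \<longleftrightarrow>
     (\<exists>H. induced_subgraph H (with_proj G) \<and> H \<noteq> with_proj G \<and> K\<^bsub>1,3\<^esub> H)"

lemma adjacency_matrix_wrt_similar:
  assumes "distinct vs" "distinct ws" "set vs = set ws"
  shows "similar_mat (adjacency_matrix_wrt vs G :: 'b :: comm_ring_1 mat)
    (adjacency_matrix_wrt ws G)"
proof -
  define n where "n = length vs"
  have n: "length ws = n" using assms by (metis distinct_card n_def)
  let ?A = "adjacency_matrix_wrt vs G :: 'b mat"
  let ?B = "adjacency_matrix_wrt ws G :: 'b mat"
  have "\<exists>k<n. ws ! k = vs ! i" if "i < n" for i
    using that assms(3) n by (metis in_set_conv_nth n_def)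
  then obtain p where p: "\<And>i. i < n \<Longrightarrow> p i < n \<and> ws ! p i = vs ! i" by metis
  have "\<exists>k<n. vs ! k = ws ! i" if "i < n" for i
    using that assms(3) n by (metis in_set_conv_nth n_def)
  then obtain q where q: "\<And>i. i < n \<Longrightarrow> q i < n \<and> vs ! q i = ws ! i" by metis
  have pq: "p i = j \<longleftrightarrow> i = q j" if "i < n" "j < n" for i j
    using that p q assms n n_def by (metis nth_eq_iff_index_eq)
  define P :: "'b mat" where "P = mat n n (\<lambda>(i, j). if p i = j then 1 else 0)"
  define Q :: "'b mat" where "Q = mat n n (\<lambda>(i, j). if q i = j then 1 else 0)"
  have qp: "q (p i) = i" "p (q i) = i" if "i < n" for i
    using that pq[of i "p i"] pq[of "q i" i] p[of i] q[of i] by auto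
  have A: "?A \<in> carrier_mat n n" and B: "?B \<in> carrier_mat n n"
    by (auto simp: adjacency_matrix_wrt_def n n_def)
  have P: "P \<in> carrier_mat n n" and Q: "Q \<in> carrier_mat n n"
    by (auto simp: P_def Q_def)
  have PM: "(P * M) $$ (i, j) = M $$ (p i, j)"
    if "M \<in> carrier_mat n n" "i < n" "j < n" for M :: "'b mat" and i j
  proof -
    have "(P * M) $$ (i, j) = (\<Sum>k\<in>{0..<n}. (if p i = k then 1 else 0) * M $$ (k, j))"
      using that by (auto simp: P_def scalar_prod_def)
    also have "\<dots> = (\<Sum>k\<in>{0..<n}. if p i = k then M $$ (k, j) else 0)"
      by (intro sum.cong) auto
    finally show ?thesis using p that by simp
  qed
  have MQ: "(M * Q) $$ (i, j) = M $$ (i, p j)"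
    if "M \<in> carrier_mat n n" "i < n" "j < n" for M :: "'b mat" and i j
  proof -
    have "(M * Q) $$ (i, j) = (\<Sum>k\<in>{0..<n}. M $$ (i, k) * (if q k = j then 1 else 0))"
      using that by (auto simp: Q_def scalar_prod_def)
    also have "\<dots> = (\<Sum>k\<in>{0..<n}. if p j = k then M $$ (i, k) else 0)"
      using pq that by (intro sum.cong) auto
    finally show ?thesis using p that by simp
  qed
  have QM: "Q * P = 1\<^sub>m n"
  proof (rule eq_matI)
    fix i j assume "i < dim_row (1\<^sub>m n)" "j < dim_col (1\<^sub>m n)"
    then have ij: "i < n" "j < n" by auto
    have "(Q * P) $$ (i, j) = (\<Sum>k\<in>{0..<n}. (if q i = k then 1 else 0) * P $$ (k, j))"
      using ij P by (auto simp: Q_def scalar_prod_def)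
    also have "\<dots> = (\<Sum>k\<in>{0..<n}. if q i = k then P $$ (k, j) else 0)"
      by (intro sum.cong) auto
    also have "\<dots> = P $$ (q i, j)" using q ij by simp
    also have "\<dots> = 1\<^sub>m n $$ (i, j)" using q ij qp by (auto simp: P_def)
    finally show "(Q * P) $$ (i, j) = 1\<^sub>m n $$ (i, j)" .
  qed (use P Q in auto)
  have PQ: "P * Q = 1\<^sub>m n"
  proof (rule eq_matI)
    fix i j assume "i < dim_row (1\<^sub>m n)" "j < dim_col (1\<^sub>m n)"
    then show "(P * Q) $$ (i, j) = 1\<^sub>m n $$ (i, j)"
      using PM[OF Q] p qp by (auto simp: Q_def)
  qed (use P Q in auto)
  have "?A = P * ?B * Q"
  proof (rule eq_matI)
    fix i j assume "i < dim_row (P * ?B * Q)" "j < dim_col (P * ?B * Q)"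
    then have ij: "i < n" "j < n" using P Q by auto
    have "(P * ?B * Q) $$ (i, j) = ?B $$ (p i, p j)"
      using MQ[of "P * ?B"] PM[OF B, of i "p j"] P B ij p by simp
    also have "\<dots> = ?A $$ (i, j)"
      using ij p n by (auto simp: adjacency_matrix_wrt_def n_def)
    finally show "?A $$ (i, j) = (P * ?B * Q) $$ (i, j)" by simp
  qed (use A P Q in auto)
  then show ?thesis
    unfolding similar_mat_def similar_mat_wit_def Let_def
    using A B P Q PQ QM by (intro exI[of _ P] exI[of _ Q]) auto
qed

lemma char_poly_adjacency_matrix_eq:
  assumes "distinct vs" "set vs = pverts G"
  shows "char_poly (adjacency_matrix G :: 'b :: comm_ring_1 mat) =
    char_poly (adjacency_matrix_wrt vs G)"
proof -
  let ?ws = "SOME vs. distinct vs \<and> set vs = pverts G"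
  have "distinct ?ws \<and> set ?ws = pverts G"
    by (rule someI[where P = "\<lambda>vs. distinct vs \<and> set vs = pverts G"]) (use assms in blast)
  then show ?thesis
    unfolding adjacency_matrix_def
    using assms by (intro char_poly_similar adjacency_matrix_wrt_similar) auto
qed

lemma pverts_starlike_tree_eq:
  "pverts (starlike_tree ns) = insert Centre
     ((\<lambda>(i, j, l). Leg i j l) `
       (SIGMA i:{1..length ns}. {..<ns ! (i - 1)} \<times> {1..i}))"
  by (force simp: starlike_tree_def)

lemma card_pverts_starlike_tree:
  "card (pverts (starlike_tree ns)) = (\<Sum>i = 1..length ns. i * ns ! (i - 1)) + 1"
proof -
  have "inj (\<lambda>(i, j, l). Leg i j l)" by (auto simp: inj_on_def)
  then have "card ((\<lambda>(i, j, l). Leg i j l) `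
      (SIGMA i:{1..length ns}. {..<ns ! (i - 1)} \<times> {1..i})) =
      card (SIGMA i:{1..length ns}. {..<ns ! (i - 1)} \<times> {1..i})"
    by (intro card_image) (auto simp: inj_on_def)
  also have "\<dots> = (\<Sum>i = 1..length ns. i * ns ! (i - 1))"
    by (subst card_SigmaI) (auto simp: card_cartesian_product mult.commute)
  finally show ?thesis
    unfolding pverts_starlike_tree_eq by (subst card_insert_disjoint) auto
qed

lemma pair_graph_starlike_tree: "pair_graph (starlike_tree ns)"
proof -
  have V: "finite (pverts (starlike_tree ns))"
    unfolding pverts_starlike_tree_eq by auto
  have E: "parcs (starlike_tree ns) \<subseteq> pverts (starlike_tree ns) \<times> pverts (starlike_tree ns)"
    by (auto simp: starlike_tree_def starlike_edges_def)
  then have F: "finite (parcs (starlike_tree ns))"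
    using V by (meson finite_SigmaI finite_subset)
  have S: "sym (parcs (starlike_tree ns))"
    by (auto simp: starlike_tree_def sym_def)
  have L: "(x, x) \<notin> parcs (starlike_tree ns)" for x
    by (auto simp: starlike_tree_def starlike_edges_def)
  show ?thesis
    by unfold_locales (use V E F S L in \<open>auto simp: symmetric_def\<close>)
qed

end

theory Submission
  imports Defs
begin

text \<open>Eliminating from the leaves to the centre shows
  \<open>f\<^sub>T(x) = (x - \<Sum>\<^sub>i n\<^sub>i p\<^bsub>i-1\<^esub>(x) / p\<^sub>i(x)) \<cdot> \<Prod>\<^sub>i p\<^sub>i(x)\<^bsup>n_i\<^esup>\<close> for \<open>x \<ge> 2\<close>, where \<open>p\<^sub>i\<close> belongs to the
  path on \<open>i\<close> vertices. This yields the four characteristic polynomials.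

  Conversely a root \<open>\<surd>c\<close> with \<open>c \<ge> 4\<close> gives \<open>\<Sum>\<^sub>i n\<^sub>i q\<^sub>i = c\<close> for \<open>q\<^sub>i = \<surd>c p\<^bsub>i-1\<^esub>(\<surd>c) / p\<^sub>i(\<surd>c)\<close>, and
  integrality of \<open>c\<close> alone decides everything. With \<open>m\<close> the degree of the centre, \<open>1 \<le> q\<^sub>i\<close> forces
  \<open>c \<ge> m\<close>, with equality only for the star, and the growth of \<open>q\<close> forces \<open>c \<le> m + 1\<close>. If
  \<open>c = m + 1\<close>, then the average of \<open>q\<close> over the \<open>m\<close> legs is \<open>q\<^sub>2 = (m + 1) / m\<close>. Either all legs
  have two vertices or, since long legs exceed this average only by about \<open>1 / m\<^sup>2\<close>, there is exactly
  one pendant vertex and at most one leg with two vertices. The remaining legs then have average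
  \<open>q\<^sub>3\<close> or \<open>q\<^sub>5\<close>. As \<open>q\<close> increases strictly, all of them have three vertices in the first
  case. In the second case all have five, since the excess over \<open>q\<^sub>5\<close> of arbitrarily long legs is too
  small to compensate for a leg with three or four vertices.\<close>

section \<open>Characteristic polynomials of rooted trees and isomorphic graphs\<close>

lemma poly_char_poly:
  fixes A :: "'a :: field mat"
  assumes "A \<in> carrier_mat n n"
  shows "poly (char_poly A) x = det (x \<cdot>\<^sub>m 1\<^sub>m n - A)"
proof -
  have "- char_matrix A x = x \<cdot>\<^sub>m 1\<^sub>m n - A"
    using assms by (intro eq_matI) (auto simp: char_matrix_def)
  then show ?thesis
    using char_poly_matrix[OF assms] by simp
qed

text \<open>Gaussian elimination from the leaves towards the root (the Jacobs--Trevisan algorithm)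
  factors \<open>xI - A\<close> as \<open>U D U\<^sup>T\<close>, where \<open>D\<close> holds the pivots \<open>d\<close> and \<open>U\<close> is unitriangular
  as soon as the vertices are listed by increasing depth.\<close>

lemma poly_char_poly_rooted_tree:
  fixes G :: "'v pair_pre_digraph" and x :: "'b :: field" and depth :: "'v \<Rightarrow> nat"
  assumes fin: "finite (pverts G)"
    and parent: "\<And>v. v \<in> pverts G \<Longrightarrow> v \<noteq> r \<Longrightarrow>
      parent v \<in> pverts G \<and> depth (parent v) < depth v"
    and arcs: "\<And>u v. u \<in> pverts G \<Longrightarrow> v \<in> pverts G \<Longrightarrow>
      (u, v) \<in> parcs G \<longleftrightarrow> v \<noteq> r \<and> u = parent v \<or> u \<noteq> r \<and> v = parent u"
    and nz: "\<And>v. v \<in> pverts G \<Longrightarrow> v \<noteq> r \<Longrightarrow> d v \<noteq> 0"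
    and pivot: "\<And>v. v \<in> pverts G \<Longrightarrow>
      d v = x - (\<Sum>w | w \<in> pverts G \<and> w \<noteq> r \<and> parent w = v. 1 / d w)"
  shows "poly (char_poly (adjacency_matrix G)) x = (\<Prod>v\<in>pverts G. d v)"
proof -
  let ?V = "pverts G"
  obtain us where us: "distinct us" "set us = ?V"
    using finite_distinct_list[OF fin] by blast
  define vs where "vs = sort_key depth us"
  have vs: "distinct vs" "set vs = ?V" and "sorted (map depth vs)"
    using us by (auto simp: vs_def)
  define n where "n = length vs"
  have mono: "depth (vs ! i) \<le> depth (vs ! j)" if "i \<le> j" "j < n" for i j
    using that \<open>sorted (map depth vs)\<close> by (auto simp: n_def sorted_iff_nth_mono)
  have V: "vs ! i \<in> ?V" if "i < n" for i
    using that nth_mem[of i vs] unfolding vs(2) n_def by blast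
  have nth_eq: "vs ! i = vs ! j \<longleftrightarrow> i = j" if "i < n" "j < n" for i j
    using that nth_eq_iff_index_eq[OF vs(1)] unfolding n_def by blast
  have bij: "bij_betw ((!) vs) {..<n} ?V"
    by (rule bij_betw_nth) (simp_all add: vs n_def)
  define U where "U u v = (if u = v then 1 else if v \<noteq> r \<and> u = parent v then - 1 / d v else 0)"
    for u v
  \<comment> \<open>\<open>M\<close> is the factor \<open>U\<close>; \<open>N\<close> is the
    diagonal matrix of the pivots times the transpose of \<open>U\<close>.\<close>
  define M N where "M = mat n n (\<lambda>(i, j). U (vs ! i) (vs ! j))"
    and "N = mat n n (\<lambda>(i, j). d (vs ! i) * U (vs ! j) (vs ! i))"
  let ?A = "adjacency_matrix_wrt vs G :: 'b mat"
  have A: "?A \<in> carrier_mat n n" and M: "M \<in> carrier_mat n n" and N: "N \<in> carrier_mat n n"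
    by (auto simp: adjacency_matrix_wrt_def n_def M_def N_def)
  have U0: "U (vs ! i) (vs ! j) = 0" if "j < i" "i < n" for i j
  proof -
    have "vs ! i \<noteq> vs ! j" using that nth_eq by auto
    moreover have "\<not> (vs ! j \<noteq> r \<and> vs ! i = parent (vs ! j))"
      using parent[OF V, of j] mono[of j i] that by auto
    ultimately show ?thesis by (auto simp: U_def)
  qed
  have entry: "(\<Sum>w\<in>?V. U u w * (d w * U v w)) =
      (if u = v then x else 0) - (if (u, v) \<in> parcs G then 1 else 0)"
    if uv: "u \<in> ?V" "v \<in> ?V" for u v
  proof -
    let ?C = "\<lambda>u. {w \<in> ?V. w \<noteq> r \<and> parent w = u}"
    have loop: "parent w \<noteq> w" if "w \<in> ?V" "w \<noteq> r" for w
      using parent[OF that] by auto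
    show ?thesis
    proof (cases "u = v")
      case True
      have "(\<Sum>w\<in>?V. U u w * (d w * U v w)) = (\<Sum>w\<in>insert u (?C u). U u w * (d w * U v w))"
        using uv fin True by (intro sum.mono_neutral_right) (auto simp: U_def)
      also have "\<dots> = d u + (\<Sum>w\<in>?C u. U u w * (d w * U v w))"
        using fin loop True by (subst sum.insert) (auto simp: U_def)
      also have "(\<Sum>w\<in>?C u. U u w * (d w * U v w)) = (\<Sum>w\<in>?C u. 1 / d w)"
        using nz loop True by (intro sum.cong) (auto simp: U_def)
      also have "d u + \<dots> = x" using pivot[OF uv(1)] by simp
      moreover have "(u, v) \<notin> parcs G"
        unfolding arcs[OF uv] using True loop[OF uv(2)] loop[OF uv(2), symmetric] by auto
      ultimately show ?thesis using True by simp
    next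
      case False
      \<comment> \<open>A vertex has only one parent, so no third vertex contributes to the sum. Of
        the terms for \<open>u\<close> and \<open>v\<close>, this fact lets at most one be
        nonzero.\<close>
      have cyc: "\<not> (u \<noteq> r \<and> v = parent u \<and> v \<noteq> r \<and> u = parent v)"
        using parent[OF uv(1)] parent[OF uv(2)] by auto
      have "(\<Sum>w\<in>?V. U u w * (d w * U v w)) = (\<Sum>w\<in>{u, v}. U u w * (d w * U v w))"
        using uv fin False by (intro sum.mono_neutral_right) (auto simp: U_def)
      also have "\<dots> = d u * U v u + U u v * d v"
        using False by (auto simp: U_def)
      also have "\<dots> = - (if (u, v) \<in> parcs G then 1 else 0)"
        using False cyc nz[OF uv(1)] nz[OF uv(2)] arcs[OF uv] by (auto simp: U_def)
      finally show ?thesis using False by simp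
    qed
  qed
  have "M * N = x \<cdot>\<^sub>m 1\<^sub>m n - ?A"
  proof (rule eq_matI)
    fix i j assume "i < dim_row (x \<cdot>\<^sub>m 1\<^sub>m n - ?A)" "j < dim_col (x \<cdot>\<^sub>m 1\<^sub>m n - ?A)"
    then have ij: "i < n" "j < n" using A by auto
    then have "(M * N) $$ (i, j) =
        (\<Sum>k\<in>{..<n}. U (vs ! i) (vs ! k) * (d (vs ! k) * U (vs ! j) (vs ! k)))"
      by (auto simp: M_def N_def scalar_prod_def atLeast0LessThan)
    also have "\<dots> = (\<Sum>w\<in>?V. U (vs ! i) w * (d w * U (vs ! j) w))"
      by (rule sum.reindex_bij_betw[OF bij])
    also have "\<dots> = (x \<cdot>\<^sub>m 1\<^sub>m n - ?A) $$ (i, j)"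
      using ij A by (subst entry) (auto simp: V nth_eq adjacency_matrix_wrt_def n_def[symmetric])
    finally show "(M * N) $$ (i, j) = (x \<cdot>\<^sub>m 1\<^sub>m n - ?A) $$ (i, j)" .
  qed (use A M N in auto)
  then have "poly (char_poly ?A) x = det M * det N"
    using det_mult[OF M N] poly_char_poly[OF A] by simp
  also have "det M = prod_list (diag_mat M)"
    using U0 by (intro det_upper_triangular[OF _ M]) (auto simp: M_def)
  also have "\<dots> = 1"
    using M by (simp add: prod_list_diag_prod M_def U_def)
  also have "det N = prod_list (diag_mat N)"
    using U0 by (intro det_lower_triangular[OF _ N]) (auto simp: N_def)
  also have "\<dots> = (\<Prod>k\<in>{..<n}. d (vs ! k))"
    using N by (simp add: prod_list_diag_prod N_def U_def atLeast0LessThan)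
  also have "\<dots> = (\<Prod>v\<in>?V. d v)"
    by (rule prod.reindex_bij_betw[OF bij])
  finally show ?thesis
    unfolding char_poly_adjacency_matrix_eq[OF vs] by simp
qed

section \<open>Integer characteristic polynomial, eigenvalues and invariance under
  isomorphism\<close>

lemma char_poly_adjacency_matrix_of_int:
  "char_poly (adjacency_matrix G :: real mat) = map_poly real_of_int (graph_char_poly G)"
proof -
  let ?vs = "SOME vs. distinct vs \<and> set vs = pverts G"
  have "(adjacency_matrix G :: real mat) = map_mat real_of_int (adjacency_matrix G)"
    by (intro eq_matI) (auto simp: adjacency_matrix_def adjacency_matrix_wrt_def)
  moreover have "(adjacency_matrix G :: int mat) \<in> carrier_mat (length ?vs) (length ?vs)"
    by (auto simp: adjacency_matrix_def adjacency_matrix_wrt_def)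
  ultimately show ?thesis
    by (simp add: graph_char_poly_def of_int_hom.char_poly_hom)
qed

lemma
  shows finite_graph_eigenvalues: "finite (graph_eigenvalues G)"
    and graph_eigenvalues_eq_roots:
      "graph_eigenvalues G = {x. poly (map_poly real_of_int (graph_char_poly G)) x = 0}"
proof -
  let ?vs = "SOME vs. distinct vs \<and> set vs = pverts G"
  have A: "(adjacency_matrix G :: real mat) \<in> carrier_mat (length ?vs) (length ?vs)"
    by (auto simp: adjacency_matrix_def adjacency_matrix_wrt_def)
  show "finite (graph_eigenvalues G)"
    unfolding graph_eigenvalues_def by (rule card_finite_spectrum(1)[OF A])
  show "graph_eigenvalues G = {x. poly (map_poly real_of_int (graph_char_poly G)) x = 0}"
    unfolding graph_eigenvalues_def spectrum_root_char_poly[OF A]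
      char_poly_adjacency_matrix_of_int ..
qed

lemma graph_char_poly_iso:
  assumes "finite (pverts G)" "digraph_iso (with_proj G) (with_proj H)"
  shows "graph_char_poly G = graph_char_poly H"
proof -
  obtain h where h: "pre_digraph.digraph_isomorphism (with_proj G) h"
    and H: "with_proj H = app_iso h (with_proj G)"
    using assms(2) by (auto simp: digraph_iso_def)
  define f where "f = iso_verts h"
  have wf: "wf_digraph (with_proj G)" and inj: "inj_on f (pverts G)"
    and ends: "\<And>a. a \<in> parcs G \<Longrightarrow>
      f (fst a) = iso_tail h (iso_arcs h a) \<and> f (snd a) = iso_head h (iso_arcs h a)"
    using h by (auto simp: pre_digraph.digraph_isomorphism_def f_def)
  \<comment> \<open>Tails and heads are the projections in both graphs, so the map on arcs is
    induced by the map on vertices.\<close>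
  have "iso_tail h = fst" "iso_head h = snd"
    using arg_cong[OF H, of tail] arg_cong[OF H, of head] by auto
  then have arc: "iso_arcs h a = (f (fst a), f (snd a))" if "a \<in> parcs G" for a
    using ends[OF that] by (metis prod.collapse)
  have VH: "pverts H = f ` pverts G"
    using arg_cong[OF H, of verts] by (simp add: f_def)
  have EH: "parcs H = (\<lambda>a. (f (fst a), f (snd a))) ` parcs G"
    using arg_cong[OF H, of arcs] arc by simp
  have E: "(f u, f v) \<in> parcs H \<longleftrightarrow> (u, v) \<in> parcs G" if "u \<in> pverts G" "v \<in> pverts G" for u v
  proof
    assume "(f u, f v) \<in> parcs H"
    then obtain a where a: "a \<in> parcs G" "f u = f (fst a)" "f v = f (snd a)"
      by (auto simp: EH)
    moreover have "fst a \<in> pverts G" "snd a \<in> pverts G"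
      using wf_digraph.tail_in_verts[OF wf, of a] wf_digraph.head_in_verts[OF wf, of a] a by auto
    ultimately have "u = fst a" "v = snd a"
      using inj that by (auto dest: inj_onD)
    then show "(u, v) \<in> parcs G" using a by simp
  qed (force simp: EH)
  obtain vs where vs: "distinct vs" "set vs = pverts G"
    using finite_distinct_list[OF assms(1)] by blast
  have "adjacency_matrix_wrt (map f vs) H = (adjacency_matrix_wrt vs G :: int mat)"
    using E by (intro eq_matI) (auto simp: adjacency_matrix_wrt_def vs(2)[symmetric])
  moreover have "distinct (map f vs)" "set (map f vs) = pverts H"
    using vs inj VH by (auto simp: distinct_map)
  ultimately show ?thesis
    using vs char_poly_adjacency_matrix_eq[of "map f vs" H]
      char_poly_adjacency_matrix_eq[of vs G]
    by (metis graph_char_poly_def)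
qed

section \<open>Characteristic polynomials of starlike trees\<close>

text \<open>The value at \<open>x\<close> of the characteristic polynomial of a path, that is, the
  Chebyshev polynomial of the second kind \<open>U_i\<close> at \<open>x / 2\<close>.\<close>

fun path_poly :: "nat \<Rightarrow> 'a :: comm_ring_1 \<Rightarrow> 'a" where
  "path_poly 0 x = 1"
| "path_poly (Suc 0) x = x"
| "path_poly (Suc (Suc i)) x = x * path_poly (Suc i) x - path_poly i x"

text \<open>For \<open>x\<close> at least 2 the sequence is nondecreasing, and the induction carries
  this along. Positivity justifies all later divisions by path polynomials.\<close>

lemma path_poly_pos:
  fixes x :: real
  assumes "2 \<le> x"
  shows "0 < path_poly i x"
proof -
  have "0 < path_poly i x \<and> path_poly i x \<le> path_poly (Suc i) x"
  proof (induction i)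
    case (Suc i)
    then have "2 * path_poly (Suc i) x \<le> x * path_poly (Suc i) x"
      using assms by (intro mult_right_mono) auto
    then show ?case using Suc unfolding path_poly.simps by linarith
  qed (use assms in auto)
  then show ?thesis by simp
qed

text \<open>The parent of \<open>Centre\<close> is a dummy value: the elimination asks only for
  parents of other vertices.\<close>

fun leg_parent :: "starlike_vertex \<Rightarrow> starlike_vertex" where
  "leg_parent Centre = Centre"
| "leg_parent (Leg i j l) = (if l \<le> 1 then Centre else Leg i j (l - 1))"

fun leg_depth :: "starlike_vertex \<Rightarrow> nat" where
  "leg_depth Centre = 0"
| "leg_depth (Leg i j l) = l"

lemma mem_pverts_starlike_tree:
  "Centre \<in> pverts (starlike_tree ns)"
  "Leg i j l \<in> pverts (starlike_tree ns) \<longleftrightarrow> i \<in> {1..length ns} \<and> j < ns ! (i - 1) \<and> l \<in> {1..i}"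
  by (auto simp: starlike_tree_def)

lemma arcs_starlike_tree_iff:
  assumes "u \<in> pverts (starlike_tree ns)" "v \<in> pverts (starlike_tree ns)"
  shows "(u, v) \<in> parcs (starlike_tree ns) \<longleftrightarrow>
    v \<noteq> Centre \<and> u = leg_parent v \<or> u \<noteq> Centre \<and> v = leg_parent u"
proof -
  have "(a, b) \<in> starlike_edges ns \<longleftrightarrow> b \<noteq> Centre \<and> a = leg_parent b"
    if "b \<in> pverts (starlike_tree ns)" for a b
  proof (cases b)
    case Centre
    then show ?thesis by (auto simp: starlike_edges_def)
  next
    case (Leg i j l)
    then show ?thesis
      using that by (cases "l = 1") (auto simp: starlike_edges_def mem_pverts_starlike_tree)
  qed
  then show ?thesis using assms by (auto simp: starlike_tree_def[of ns])
qed

lemma poly_graph_char_poly_starlike_tree: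
  fixes x :: real
  assumes "2 \<le> x"
  shows "poly (map_poly of_int (graph_char_poly (starlike_tree ns))) x =
    (x - (\<Sum>i=1..length ns. real (ns ! (i - 1)) * (path_poly (i - 1) x / path_poly i x))) *
    (\<Prod>i=1..length ns. path_poly i x ^ (ns ! (i - 1)))"
proof -
  let ?T = "starlike_tree ns"
  define S where "S = (\<Sum>i=1..length ns. real (ns ! (i - 1)) * (path_poly (i - 1) x / path_poly i x))"
  \<comment> \<open>From position \<open>l\<close> outwards a leg is a path on
    \<open>i - l + 1\<close> vertices. Its pivot is the ratio of consecutive path polynomials, which
    is \<open>x\<close> at the leaf \<open>l = i\<close>.\<close>
  define d where "d v = (case v of Centre \<Rightarrow> x - S
    | Leg i j l \<Rightarrow> path_poly (Suc (i - l)) x / path_poly (i - l) x)" for v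
  note pos = path_poly_pos[OF assms]
  have "poly (char_poly (adjacency_matrix ?T)) x = (\<Prod>v\<in>pverts ?T. d v)"
  proof (rule poly_char_poly_rooted_tree[where parent = leg_parent and r = Centre and depth = leg_depth])
    fix v assume v: "v \<in> pverts ?T"
    show "leg_parent v \<in> pverts ?T \<and> leg_depth (leg_parent v) < leg_depth v" if "v \<noteq> Centre"
      using v that by (cases v) (auto simp: mem_pverts_starlike_tree)
    show "d v \<noteq> 0" if "v \<noteq> Centre"
      using v that pos by (cases v) (auto simp: d_def less_imp_neq[symmetric] simp del: path_poly.simps)
    show "d v = x - (\<Sum>w | w \<in> pverts ?T \<and> w \<noteq> Centre \<and> leg_parent w = v. 1 / d w)"
    proof (cases v)
      case Centre
      have "{w. w \<in> pverts ?T \<and> w \<noteq> Centre \<and> leg_parent w = v} =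
          (\<lambda>(i, j). Leg i j 1) ` (SIGMA i:{1..length ns}. {..<ns ! (i - 1)})" (is "?C = _")
      proof (intro equalityI subsetI)
        fix w assume "w \<in> ?C"
        then show "w \<in> (\<lambda>(i, j). Leg i j 1) ` (SIGMA i:{1..length ns}. {..<ns ! (i - 1)})"
          using Centre by (cases w) (auto simp: mem_pverts_starlike_tree image_iff split: if_splits)
      qed (use Centre in \<open>auto simp: mem_pverts_starlike_tree\<close>)
      moreover have "inj (\<lambda>(i, j). Leg i j 1)" by (auto simp: inj_on_def)
      ultimately have "(\<Sum>w\<in>?C. 1 / d w) =
          (\<Sum>(i, j)\<in>(SIGMA i:{1..length ns}. {..<ns ! (i - 1)}). 1 / d (Leg i j 1))"
        by (simp add: sum.reindex inj_on_subset case_prod_unfold comp_def)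
      also have "\<dots> = (\<Sum>i=1..length ns. \<Sum>j<ns ! (i - 1). 1 / d (Leg i j 1))"
        by (rule sum.Sigma[symmetric]) auto
      also have "\<dots> = S"
        unfolding S_def by (intro sum.cong) (auto simp: d_def Suc_diff_le)
      finally show ?thesis using Centre by (simp add: d_def)
    next
      case (Leg i j l)
      have "{w. w \<in> pverts ?T \<and> w \<noteq> Centre \<and> leg_parent w = v} =
          (if l < i then {Leg i j (Suc l)} else {})" (is "?C = _")
      proof (intro equalityI subsetI)
        fix w assume "w \<in> ?C"
        then show "w \<in> (if l < i then {Leg i j (Suc l)} else {})"
          using Leg v by (cases w) (auto simp: mem_pverts_starlike_tree split: if_splits)
      qed (use Leg v in \<open>auto simp: mem_pverts_starlike_tree split: if_splits\<close>)
      then have C: "(\<Sum>w\<in>?C. 1 / d w) = (if l < i then 1 / d (Leg i j (Suc l)) else 0)" by simp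
      show ?thesis
      proof (cases "l < i")
        case True
        then obtain k where "i - l = Suc k" "i - Suc l = k"
          by (metis Suc_diff_Suc)
        then show ?thesis
          unfolding C using True Leg pos[of k] pos[of "Suc k"]
          by (simp add: d_def field_simps)
      next
        case False
        then have "i - l = 0" by simp
        then show ?thesis
          unfolding C using False Leg by (simp add: d_def)
      qed
    qed
  qed (use arcs_starlike_tree_iff in \<open>auto simp: pverts_starlike_tree_eq\<close>)
  also have "\<dots> = d Centre * (\<Prod>(i, j, l)\<in>(SIGMA i:{1..length ns}. {..<ns ! (i - 1)} \<times> {1..i}).
      d (Leg i j l))"
  proof -
    have "inj (\<lambda>(i, j, l). Leg i j l)" by (auto simp: inj_on_def)
    then show ?thesis
      unfolding pverts_starlike_tree_eq
      by (subst prod.insert) (auto simp: prod.reindex inj_on_subset case_prod_unfold comp_def)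
  qed
  also have "(\<Prod>(i, j, l)\<in>(SIGMA i:{1..length ns}. {..<ns ! (i - 1)} \<times> {1..i}). d (Leg i j l)) =
      (\<Prod>i=1..length ns. \<Prod>j<ns ! (i - 1). \<Prod>l=1..i. d (Leg i j l))"
    by (subst prod.Sigma[symmetric]) (auto simp: prod.cartesian_product)
  also have "\<dots> = (\<Prod>i=1..length ns. path_poly i x ^ (ns ! (i - 1)))"
  proof -
    \<comment> \<open>Along one leg the product of the pivots telescopes to a single path
      polynomial.\<close>
    have telescope: "(\<Prod>k<i. path_poly (Suc k) x / path_poly k x) = path_poly i x" for i
    proof (induction i)
      case (Suc i)
      then show ?case using pos[of i] by simp
    qed simp
    have "(\<Prod>l=1..i. d (Leg i j l)) = path_poly i x" for i j
    proof -
      have "(\<Prod>l=1..i. d (Leg i j l)) =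
          (\<Prod>l<i. path_poly (Suc (i - Suc l)) x / path_poly (i - Suc l) x)"
        by (simp add: d_def prod.atLeast1_atMost_eq)
      then show ?thesis
        by (simp only: prod.nat_diff_reindex[of "\<lambda>k. path_poly (Suc k) x / path_poly k x"] telescope)
    qed
    then show ?thesis by simp
  qed
  finally show ?thesis
    by (simp add: char_poly_adjacency_matrix_of_int d_def S_def)
qed

text \<open>The elimination formula is available only where no pivot vanishes. Agreement on an
  infinite set of reals suffices, since a nonzero polynomial has finitely many roots.\<close>

lemma int_poly_eqI:
  fixes p q :: "int poly"
  assumes "\<And>x :: real. 2 < x \<Longrightarrow> poly (map_poly of_int p) x = poly (map_poly of_int q) x"
  shows "p = q"
proof -
  let ?d = "map_poly real_of_int p - map_poly real_of_int q"
  have "{2<..} \<subseteq> {x. poly ?d x = 0}" using assms by auto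
  then have "infinite {x. poly ?d x = 0}" using infinite_Ioi finite_subset by blast
  then have "?d = 0" using poly_roots_finite by blast
  then show ?thesis by (simp add: poly_eq_iff coeff_map_poly)
qed

section \<open>Characteristic polynomials of the four families\<close>

lemma path_poly_2: "path_poly 2 x = x\<^sup>2 - 1"
  and path_poly_3: "path_poly 3 x = x * (x\<^sup>2 - 2)"
  and path_poly_4: "path_poly 4 x = (x\<^sup>2 - x - 1) * (x\<^sup>2 + x - 1)"
  and path_poly_5: "path_poly 5 x = x * (x\<^sup>2 - 1) * (x\<^sup>2 - 3)"
  by (simp_all add: eval_nat_numeral algebra_simps)

lemmas path_poly_numeral =
  path_poly.simps(1) path_poly.simps(2)[folded One_nat_def] path_poly_2 path_poly_3 path_poly_4 path_poly_5

lemma poly_map_of_int: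
  fixes x :: "'a :: comm_ring_1"
  shows "poly (map_poly of_int (p * q)) x = poly (map_poly of_int p) x * poly (map_poly of_int q) x"
    and "poly (map_poly of_int (p ^ k)) x = poly (map_poly of_int p) x ^ k"
    and "poly (map_poly of_int [:0, 1:]) x = x"
    and "poly (map_poly of_int [:-1, -1, 1:]) x = x\<^sup>2 - x - 1"
    and "poly (map_poly of_int [:-1, 1, 1:]) x = x\<^sup>2 + x - 1"
    and "poly (map_poly of_int [:- a, 0, 1:]) x = x\<^sup>2 - of_int a"
  by (simp_all add: hom_distribs power2_eq_square algebra_simps)

lemma graph_char_poly_star:
  assumes "1 \<le> n"
  shows "graph_char_poly (starlike_tree [n]) = [:0, 1:] ^ (n - 1) * [:- int n, 0, 1:]"
proof (rule int_poly_eqI)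
  fix x :: real assume x: "2 < x"
  obtain k where n: "n = Suc k" using assms by (cases n) auto
  have "poly (map_poly of_int (graph_char_poly (starlike_tree [n]))) x = (x - n * (1 / x)) * x ^ n"
    using x by (subst poly_graph_char_poly_starlike_tree) auto
  also have "\<dots> = x ^ k * (x\<^sup>2 - n)"
    using x by (simp add: n field_simps power2_eq_square)
  finally show "poly (map_poly of_int (graph_char_poly (starlike_tree [n]))) x =
      poly (map_poly of_int ([:0, 1:] ^ (n - 1) * [:- int n, 0, 1:])) x"
    unfolding poly_map_of_int by (simp add: n mult_ac)
qed

lemma graph_char_poly_starlike_0_n:
  assumes "1 \<le> n"
  shows "graph_char_poly (starlike_tree [0, n]) =
    [:0, 1:] * [:-1, 0, 1:] ^ (n - 1) * [:- (int n + 1), 0, 1:]"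
proof (rule int_poly_eqI)
  fix x :: real assume x: "2 < x"
  then have pos: "0 < x\<^sup>2 - 1" using path_poly_pos[of x 2] by (simp add: path_poly_2)
  obtain k where n: "n = Suc k" using assms by (cases n) auto
  have I: "{1..length [0, n]} = {1, 2}" by auto
  have "poly (map_poly of_int (graph_char_poly (starlike_tree [0, n]))) x =
      (x - n * (x / (x\<^sup>2 - 1))) * (x\<^sup>2 - 1) ^ n"
    unfolding poly_graph_char_poly_starlike_tree[OF less_imp_le[OF x]] I
    by (simp add: path_poly_numeral)
  also have "\<dots> = x * (x\<^sup>2 - 1) ^ k * (x\<^sup>2 - (n + 1))"
    using pos by (simp add: n field_simps)
  finally show "poly (map_poly of_int (graph_char_poly (starlike_tree [0, n]))) x =
      poly (map_poly of_int ([:0, 1:] * [:-1, 0, 1:] ^ (n - 1) * [:- (int n + 1), 0, 1:])) x"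
    unfolding poly_map_of_int by (simp add: n mult_ac)
qed

text \<open>The pendant vertex turns \<open>x\<close> into
  \<open>x - 1 / x = (x\<^sup>2 - 1) / x\<close>, which shares its numerator with the contribution
  of the longer legs. Factoring it out leaves \<open>x\<^sup>2 - 2 - n\<close>.\<close>

lemma graph_char_poly_starlike_1_0_n:
  assumes "1 \<le> n"
  shows "graph_char_poly (starlike_tree [1, 0, n]) =
    [:0, 1:] ^ n * [:-1, 0, 1:] * [:-2, 0, 1:] ^ (n - 1) * [:- (int n + 2), 0, 1:]"
proof (rule int_poly_eqI)
  fix x :: real assume x: "2 < x"
  then have "2\<^sup>2 < x\<^sup>2" by (intro power_strict_mono) auto
  then have pos: "0 < x\<^sup>2 - 2" by simp
  obtain k where n: "n = Suc k" using assms by (cases n) auto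
  have I: "{1..length [1, 0, n]} = {1, 2, 3}" by auto
  have "poly (map_poly of_int (graph_char_poly (starlike_tree [1, 0, n]))) x =
      (x - (1 / x + n * ((x\<^sup>2 - 1) / (x * (x\<^sup>2 - 2))))) * (x * (x * (x\<^sup>2 - 2)) ^ n)"
    unfolding poly_graph_char_poly_starlike_tree[OF less_imp_le[OF x]] I
    by (simp add: path_poly_numeral)
  also have "\<dots> = ((x - (1 / x + n * ((x\<^sup>2 - 1) / (x * (x\<^sup>2 - 2))))) * x * (x\<^sup>2 - 2)) *
      (x ^ n * (x\<^sup>2 - 2) ^ k)"
    by (simp add: n power_mult_distrib)
  also have "(x - (1 / x + n * ((x\<^sup>2 - 1) / (x * (x\<^sup>2 - 2))))) * x * (x\<^sup>2 - 2) =
      (x\<^sup>2 - 1) * (x\<^sup>2 - (n + 2))"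
    using x pos by (simp add: divide_simps) (simp add: algebra_simps power2_eq_square)
  finally show "poly (map_poly of_int (graph_char_poly (starlike_tree [1, 0, n]))) x =
      poly (map_poly of_int
        ([:0, 1:] ^ n * [:-1, 0, 1:] * [:-2, 0, 1:] ^ (n - 1) * [:- (int n + 2), 0, 1:])) x"
    unfolding poly_map_of_int by (simp add: n mult_ac)
qed

text \<open>The two short legs turn \<open>x\<close> into \<open>f / (x g)\<close> with
  \<open>g = x\<^sup>2 - 1\<close>, where \<open>f\<close> is the path polynomial on 4 vertices.
  This is also the numerator for the long legs, so \<open>f\<close> factors out and leaves
  \<open>x\<^sup>2 - 3 - n\<close>.\<close>

lemma graph_char_poly_starlike_1_1_0_0_n:
  assumes "1 \<le> n"
  shows "graph_char_poly (starlike_tree [1, 1, 0, 0, n]) =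
    [:0, 1:] ^ n * [:-1, 0, 1:] ^ n * [:-1, -1, 1:] * [:-1, 1, 1:] *
    [:-3, 0, 1:] ^ (n - 1) * [:- (int n + 3), 0, 1:]"
proof (rule int_poly_eqI)
  fix x :: real assume x: "2 < x"
  then have "2\<^sup>2 < x\<^sup>2" by (intro power_strict_mono) auto
  then have pos1: "0 < x\<^sup>2 - 1" and pos3: "0 < x\<^sup>2 - 3" by simp_all
  obtain k where n: "n = Suc k" using assms by (cases n) auto
  define g where "g = x\<^sup>2 - 1"
  define h where "h = x\<^sup>2 - 3"
  define f where "f = (x\<^sup>2 - x - 1) * (x\<^sup>2 + x - 1)"
  have f: "f = x\<^sup>2 * g - g - x\<^sup>2" by (simp add: f_def g_def algebra_simps power2_eq_square)
  have I: "{1..length [1, 1, 0, 0, n]} = {1, 2, 3, 4, 5}" by auto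
  have "poly (map_poly of_int (graph_char_poly (starlike_tree [1, 1, 0, 0, n]))) x =
      (x - (1 / x + (x / g + n * (f / (x * g * h))))) * (x * (g * (x * g * h) ^ n))"
    unfolding f_def g_def h_def
    unfolding poly_graph_char_poly_starlike_tree[OF less_imp_le[OF x]] I
    by (simp add: path_poly_numeral)
  also have "\<dots> = ((x - (1 / x + (x / g + n * (f / (x * g * h))))) * x * g * h) *
      (x ^ n * g ^ n * h ^ k)"
    by (simp add: n power_mult_distrib)
  also have "(x - (1 / x + (x / g + n * (f / (x * g * h))))) * x * g * h =
      (x\<^sup>2 * g - g - x\<^sup>2) * h - n * f"
    using x pos1 pos3 unfolding g_def[symmetric] h_def[symmetric]
    by (simp add: divide_simps) (simp add: algebra_simps power2_eq_square)
  also have "\<dots> = f * (x\<^sup>2 - (n + 3))"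
    unfolding f[symmetric] by (simp add: h_def algebra_simps)
  finally show "poly (map_poly of_int (graph_char_poly (starlike_tree [1, 1, 0, 0, n]))) x =
      poly (map_poly of_int ([:0, 1:] ^ n * [:-1, 0, 1:] ^ n * [:-1, -1, 1:] * [:-1, 1, 1:] *
        [:-3, 0, 1:] ^ (n - 1) * [:- (int n + 3), 0, 1:])) x"
    unfolding poly_map_of_int by (simp add: n f_def g_def h_def mult_ac)
qed

section \<open>Number of legs and length of the legs\<close>

text \<open>For \<open>y = x\<^sup>2\<close>, \<open>leg_ratio y i\<close> is \<open>x p\<^bsub>i-1\<^esub>(x) / p\<^sub>i(x)\<close>, where \<open>p\<^sub>i\<close> is the characteristic
  polynomial of the path on \<open>i\<close> vertices.\<close>

fun leg_ratio :: "real \<Rightarrow> nat \<Rightarrow> real" where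
  "leg_ratio y 0 = 0"
| "leg_ratio y (Suc i) = y / (y - leg_ratio y i)"

text \<open>The map \<open>t \<mapsto> y / (y - t)\<close> is increasing below \<open>y\<close> and
  sends \<open>b\<close> to at most \<open>b\<close>, so its iterates from 0 stay below
  \<open>b\<close>. All bounds uniform in the leg length are instances.\<close>

lemma leg_ratio_less:
  assumes "1 < b" "b < y" "y \<le> b * (y - b)"
  shows "leg_ratio y i < b"
proof (induction i)
  case (Suc i)
  have "y / (y - leg_ratio y i) < y / (y - b)"
    using Suc assms by (intro divide_strict_left_mono) auto
  also have "\<dots> \<le> b"
    using assms by (simp add: divide_simps)
  finally show ?case by simp
qed (use assms in auto)

lemma leg_ratio_less_2: "4 \<le> y \<Longrightarrow> leg_ratio y i < 2"
  by (rule leg_ratio_less) auto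

lemma leg_ratio_Suc_less:
  assumes "4 \<le> y"
  shows "leg_ratio y i < leg_ratio y (Suc i)"
proof (induction i)
  case 0
  then show ?case using assms by simp
next
  case (Suc i)
  have "y / (y - leg_ratio y i) < y / (y - leg_ratio y (Suc i))"
    using Suc leg_ratio_less_2[OF assms, of "Suc i"] leg_ratio_less_2[OF assms, of i] assms
    by (intro divide_strict_left_mono) auto
  then show ?case by simp
qed

lemma strict_mono_leg_ratio: "4 \<le> y \<Longrightarrow> strict_mono (leg_ratio y)"
  by (rule strict_mono_Suc_iff[THEN iffD2]) (use leg_ratio_Suc_less in blast)

lemma leg_ratio_1: "4 \<le> y \<Longrightarrow> leg_ratio y 1 = 1"
  by simp

section \<open>Exact ratios of short legs and bounds for all legs at
  \<open>y = m + 1\<close>\<close>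

lemma leg_ratio_2: "leg_ratio (m + 1) 2 = (m + 1) / m" if "3 \<le> m"
  using that by (simp add: numeral_eq_Suc)

lemma leg_ratio_3: "leg_ratio (m + 1) 3 = m / (m - 1)" if "3 \<le> m"
proof -
  have "leg_ratio (m + 1) 3 = (m + 1) / (m + 1 - (m + 1) / m)"
    using leg_ratio_2[OF that] by (simp add: numeral_eq_Suc)
  also have "\<dots> = m / (m - 1)"
    using that by (simp add: divide_simps) (simp add: algebra_simps)
  finally show ?thesis .
qed

lemma square_minus_self_gt_1: "0 < m\<^sup>2 - m - 1" if "3 \<le> m" for m :: real
proof -
  have "3 * m \<le> m * m" using that by (intro mult_right_mono) auto
  then show ?thesis using that unfolding power2_eq_square by linarith
qed

lemma leg_ratio_4: "leg_ratio (m + 1) 4 = (m + 1) * (m - 1) / (m\<^sup>2 - m - 1)" if "3 \<le> m"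
proof -
  note p = square_minus_self_gt_1[OF that]
  have "leg_ratio (m + 1) 4 = (m + 1) / (m + 1 - m / (m - 1))"
    using leg_ratio_3[OF that] by (simp add: numeral_eq_Suc)
  also have "m + 1 - m / (m - 1) = (m\<^sup>2 - m - 1) / (m - 1)"
    using that by (simp add: field_simps power2_eq_square)
  finally show ?thesis using that by simp
qed

lemma leg_ratio_5: "leg_ratio (m + 1) 5 = (m\<^sup>2 - m - 1) / (m * (m - 2))" if "3 \<le> m"
proof -
  note p = square_minus_self_gt_1[OF that]
  have "leg_ratio (m + 1) 5 = (m + 1) / (m + 1 - leg_ratio (m + 1) 4)"
    by (simp add: numeral_eq_Suc)
  also have "m + 1 - leg_ratio (m + 1) 4 = (m + 1) * (m * (m - 2)) / (m\<^sup>2 - m - 1)"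
    unfolding leg_ratio_4[OF that] using p by (simp add: field_simps power2_eq_square)
  finally show ?thesis using that by simp
qed


text \<open>The constant 11/8 is the value at \<open>m = 4\<close>. It is small enough for
  \<open>3 - 2 * a - d\<close> to be nonnegative in \<open>leg_ratio_less_fine\<close>, where
  \<open>d\<close> is at most 1/4.\<close>

lemma leg_ratio_5_bounds:
  assumes "4 \<le> m"
  shows "1 < leg_ratio (m + 1) 5" "leg_ratio (m + 1) 5 \<le> 11 / 8"
proof -
  have m: "0 < m * (m - 2)" using assms by simp
  have "0 \<le> (m - 4) * (3 * m - 2)" using assms by simp
  then have "8 * (m\<^sup>2 - m - 1) \<le> 11 * (m * (m - 2))"
    by (simp add: algebra_simps power2_eq_square)
  then show "leg_ratio (m + 1) 5 \<le> 11 / 8"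
    using assms m by (subst leg_ratio_5) (auto simp: pos_divide_le_eq)
  have "m * (m - 2) < m\<^sup>2 - m - 1"
    using assms by (simp add: algebra_simps power2_eq_square)
  then show "1 < leg_ratio (m + 1) 5"
    using assms m by (subst leg_ratio_5) (auto simp: pos_less_divide_eq)
qed

text \<open>As \<open>1 + 1 / m\<close> is the ratio of a leg with 2 vertices, no leg exceeds that
  ratio by \<open>1 / (m * (m - 3))\<close> or more. This limits the number of pendant
  vertices.\<close>

lemma leg_ratio_less_coarse:
  assumes "4 \<le> m"
  shows "leg_ratio (m + 1) i < 1 + 1 / m + 1 / (m * (m - 3))"
proof (rule leg_ratio_less)
  define b where "b = 1 + 1 / m + 1 / (m * (m - 3))"
  have pos: "0 < m * (m - 3)" using assms by simp
  then show "1 < 1 + 1 / m + 1 / (m * (m - 3))" using assms by (simp add: add_pos_pos)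
  have "1 / m \<le> 1" using assms by simp
  moreover have "1 / (m * (m - 3)) \<le> 1"
    using assms mult_mono[of 1 m 1 "m - 3"] by simp
  ultimately show "1 + 1 / m + 1 / (m * (m - 3)) < m + 1" using assms by linarith
  have b: "b = (m\<^sup>2 - 2 * m - 2) / (m * (m - 3))"
    using assms unfolding b_def by (simp add: divide_simps) (simp add: algebra_simps power2_eq_square)
  have "b * (m + 1 - b) - (m + 1) =
      ((m + 1) * (m - 2) * (m * (m - 3)) - (m\<^sup>2 - 2 * m - 2)\<^sup>2) / (m * (m - 3))\<^sup>2"
    unfolding b using assms by (simp add: divide_simps) (simp add: algebra_simps power2_eq_square)
  also have "(m + 1) * (m - 2) * (m * (m - 3)) - (m\<^sup>2 - 2 * m - 2)\<^sup>2 = (m - 4) * (m + 2) + 4"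
    by (simp add: algebra_simps power2_eq_square)
  also have "\<dots> / (m * (m - 3))\<^sup>2 \<ge> 0" using assms by (intro divide_nonneg_nonneg) auto
  finally show "m + 1 \<le> (1 + 1 / m + 1 / (m * (m - 3))) * (m + 1 - (1 + 1 / m + 1 / (m * (m - 3))))"
    unfolding b_def by simp
qed

text \<open>The ratio \<open>a\<close> of a leg with 5 vertices misses the criterion of
  \<open>leg_ratio_less\<close> only by \<open>1 / (m * (m - 2))\<^sup>2\<close>. The increment
  \<open>d\<close> is chosen to make this defect \<open>(m - 2) * d\<close>, which the first-order
  gain \<open>(m + 1 - 2 * a) * d\<close> outweighs.\<close>

lemma leg_ratio_less_fine:
  assumes "4 \<le> m"
  shows "leg_ratio (m + 1) i < leg_ratio (m + 1) 5 + 1 / (m\<^sup>2 * (m - 2) ^ 3)"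
proof (rule leg_ratio_less)
  define a d where "a = leg_ratio (m + 1) 5" and "d = 1 / (m\<^sup>2 * (m - 2) ^ 3)"
  have a: "1 < a" "a \<le> 11 / 8"
    using leg_ratio_5_bounds[OF assms] by (auto simp: a_def)
  have d: "0 < d" using assms by (simp add: d_def)
  have "4 * 1 \<le> m\<^sup>2 * (m - 2) ^ 3"
    using assms power_mono[of 2 m 2] one_le_power[of "m - 2" 3] by (intro mult_mono) auto
  then have d4: "d \<le> 1 / 4"
    unfolding d_def by (intro divide_left_mono) auto
  show "1 < a + d" "a + d < m + 1" using a d d4 assms by linarith+
  have "a * (m + 1 - a) - (m + 1) = ((m\<^sup>2 - m - 1) * ((m + 1) * (m * (m - 2)) - (m\<^sup>2 - m - 1))
      - (m + 1) * (m * (m - 2))\<^sup>2) / (m * (m - 2))\<^sup>2"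
    unfolding a_def leg_ratio_5[OF order.trans[OF _ assms], simplified] using assms
    by (simp add: divide_simps) (simp add: algebra_simps power2_eq_square)
  also have "(m\<^sup>2 - m - 1) * ((m + 1) * (m * (m - 2)) - (m\<^sup>2 - m - 1))
      - (m + 1) * (m * (m - 2))\<^sup>2 = - 1"
    by (simp add: algebra_simps power2_eq_square)
  also have "- 1 / (m * (m - 2))\<^sup>2 = - ((m - 2) * d)"
    unfolding d_def using assms
    by (simp add: divide_simps) (simp add: algebra_simps power2_eq_square power3_eq_cube)
  finally have "(a + d) * (m + 1 - (a + d)) - (m + 1) = d * (3 - 2 * a - d)"
    by (simp add: algebra_simps)
  also have "\<dots> \<ge> 0" using a d d4 by (intro mult_nonneg_nonneg) auto
  finally show "m + 1 \<le> (a + d) * (m + 1 - (a + d))" by simp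
qed

text \<open>Dividing the recurrence of the path polynomials by its middle term gives the recursion
  of \<open>leg_ratio\<close>.\<close>

lemma leg_ratio_path_poly:
  assumes "2 \<le> x"
  shows "leg_ratio (x\<^sup>2) (Suc i) = x * path_poly i x / path_poly (Suc i) x"
proof (induction i)
  case 0
  then show ?case using assms by (simp add: power2_eq_square)
next
  case (Suc i)
  note pos = path_poly_pos[OF assms, of "Suc i"] path_poly_pos[OF assms, of "Suc (Suc i)"]
  have "x\<^sup>2 - leg_ratio (x\<^sup>2) (Suc i) = x * path_poly (Suc (Suc i)) x / path_poly (Suc i) x"
    unfolding Suc using pos by (simp add: field_simps power2_eq_square)
  then show ?case
    using pos assms by (simp add: power2_eq_square)
qed

section \<open>Averages of leg ratios and the possible leg lengths\<close>

lemma sum_weighted_diff: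
  fixes n :: "'a \<Rightarrow> nat" and q :: "'a \<Rightarrow> real"
  shows "(\<Sum>i\<in>A. real (n i) * (q i - t)) = (\<Sum>i\<in>A. real (n i) * q i) - real (\<Sum>i\<in>A. n i) * t"
    and "(\<Sum>i\<in>A. real (n i) * (t - q i)) = real (\<Sum>i\<in>A. n i) * t - (\<Sum>i\<in>A. real (n i) * q i)"
  by (simp_all add: right_diff_distrib sum_subtractf sum_distrib_right)

lemma sum_weighted_less:
  fixes n :: "'a \<Rightarrow> nat" and q :: "'a \<Rightarrow> real"
  assumes "(\<Sum>i\<in>A. n i) \<noteq> 0" "\<And>i. i \<in> A \<Longrightarrow> q i < t"
  shows "(\<Sum>i\<in>A. real (n i) * q i) < real (\<Sum>i\<in>A. n i) * t"
proof -
  obtain a where a: "a \<in> A" "n a \<noteq> 0"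
    using assms(1) by (meson sum.neutral)
  have "finite A" using assms(1) by (meson sum.infinite)
  then have "0 < (\<Sum>i\<in>A. real (n i) * (t - q i))"
  proof (rule sum_pos2[OF _ a(1)])
    show "0 < real (n a) * (t - q a)" using a assms(2)[of a] by simp
    show "0 \<le> real (n i) * (t - q i)" if "i \<in> A" for i using assms(2)[OF that] by simp
  qed
  then show ?thesis unfolding sum_weighted_diff by simp
qed

text \<open>Nonnegative terms with sum 0 all vanish. Thus, if the average equals the least ratio
  present, longer legs do not occur.\<close>

lemma weight_eq_0_if_sum_weighted_eq_0:
  fixes n :: "'a \<Rightarrow> nat" and q :: "'a \<Rightarrow> real"
  assumes "(\<Sum>i\<in>A. real (n i) * (q i - t)) = 0" "finite A" "\<And>i. i \<in> A \<Longrightarrow> t \<le> q i"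
    and "i \<in> A" "t < q i"
  shows "n i = 0"
proof -
  have "0 \<le> real (n i) * (q i - t)" if "i \<in> A" for i using assms(3)[OF that] by simp
  then have "real (n i) * (q i - t) = 0"
    using assms(1,2,4) by (simp add: sum_nonneg_eq_0_iff)
  then show ?thesis using assms(5) by simp
qed

lemma legs_count_bounds:
  fixes n :: "nat \<Rightarrow> nat" and c :: int and k :: nat
  defines "m \<equiv> \<Sum>i=1..k. n i"
  assumes c: "4 \<le> c" and sum: "(\<Sum>i=1..k. real (n i) * leg_ratio c i) = c"
  shows "int m \<le> c" "c \<le> int m + 1"
proof -
  have y: "4 \<le> real_of_int c" using c by simp
  have q1: "1 \<le> leg_ratio c i" if "1 \<le> i" for i
    using strict_mono_less_eq[OF strict_mono_leg_ratio[OF y], of 1 i] that leg_ratio_1[OF y] by simp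
  have "real m \<le> c"
    using sum_nonneg[of "{1..k}" "\<lambda>i. real (n i) * (leg_ratio c i - 1)"] q1
    unfolding sum_weighted_diff sum m_def by simp
  then show "int m \<le> c" by linarith
  show "c \<le> int m + 1"
  proof (rule ccontr)
    assume "\<not> c \<le> int m + 1"
    then have cm: "real m + 2 \<le> c" by linarith
    have upper: "c \<le> b * real m" if "\<And>i. leg_ratio c i \<le> b" for b
      using sum_nonneg[of "{1..k}" "\<lambda>i. real (n i) * (b - leg_ratio c i)"] that
      unfolding sum_weighted_diff sum m_def by (simp add: mult.commute)
    have m: "2 \<le> real m"
      using upper[of 2, OF less_imp_le[OF leg_ratio_less_2[OF y]]] y by simp
    \<comment> \<open>\<open>b\<close> is the average ratio over all legs. For \<open>c\<close> at
      least \<open>m + 2\<close> it satisfies the criterion of \<open>leg_ratio_less\<close>, so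
      every ratio would lie strictly below the average.\<close>
    define b where "b = c / real m"
    have bm: "b * real m = c" using m by (simp add: b_def)
    have "leg_ratio c i < b" for i
    proof (rule leg_ratio_less)
      show "1 < b" using cm m by (simp add: b_def)
      show "b < c" unfolding b_def using y m by (simp add: divide_less_eq)
      have "(real m)\<^sup>2 \<le> c * (real m - 1)"
      proof -
        have "(real m + 2) * (real m - 1) \<le> c * (real m - 1)"
          using cm m by (intro mult_right_mono) auto
        then show ?thesis using m by (simp add: algebra_simps power2_eq_square)
      qed
      then have "0 \<le> c / (real m)\<^sup>2 * (c * (real m - 1) - (real m)\<^sup>2)"
        using y by (intro mult_nonneg_nonneg) auto
      also have "\<dots> = b * (c - b) - c"
        using m unfolding b_def by (simp add: divide_simps) (simp add: algebra_simps power2_eq_square)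
      finally show "c \<le> b * (c - b)" by simp
    qed note b = this
    then show False
      using sum_weighted_less[of n "{1..k}" "leg_ratio c" b] m bm
      unfolding sum m_def[symmetric] by (simp add: mult.commute)
  qed
qed

text \<open>Taking \<open>k\<close> at least 5 allows splitting the sum after the short lengths
  without asking for the longest leg; missing lengths have weight 0.\<close>

lemma legs_classification:
  fixes n :: "nat \<Rightarrow> nat" and c :: int and k :: nat
  assumes c: "4 \<le> c" and k: "5 \<le> k"
    and sum: "(\<Sum>i=1..k. real (n i) * leg_ratio c i) = c"
  obtains "\<And>i. i \<in> {1..k} \<Longrightarrow> n i = (if i = 1 then nat c else 0)"
  | "\<And>i. i \<in> {1..k} \<Longrightarrow> n i = (if i = 2 then nat (c - 1) else 0)"
  | "\<And>i. i \<in> {1..k} \<Longrightarrow> n i = (if i = 1 then 1 else if i = 3 then nat (c - 2) else 0)"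
  | "\<And>i. i \<in> {1..k} \<Longrightarrow>
      n i = (if i = 1 then 1 else if i = 2 then 1 else if i = 5 then nat (c - 3) else 0)"
proof -
  define m where "m = (\<Sum>i=1..k. n i)"
  define q where "q = leg_ratio c"
  have y: "4 \<le> real_of_int c" using c by simp
  have q_less: "q i < q j \<longleftrightarrow> i < j" and q_le: "q i \<le> q j \<longleftrightarrow> i \<le> j" for i j
    using strict_mono_leg_ratio[OF y] by (auto simp: q_def strict_mono_less strict_mono_less_eq)
  have q1: "q 1 = 1" using y by (simp add: q_def)
  have "c = int m \<or> c = int m + 1"
    using legs_count_bounds[OF c sum] by (auto simp: m_def)
  then consider "c = int m" | "c = int m + 1" by blast
  then show ?thesis
  proof cases
    case 1
    have zero: "(\<Sum>i=1..k. real (n i) * (q i - q 1)) = 0"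
      unfolding sum_weighted_diff q1 unfolding q_def sum m_def[symmetric] using 1 by simp
    have z: "n i = 0" if "i \<in> {2..k}" for i
      by (rule weight_eq_0_if_sum_weighted_eq_0[of n q "q 1" "{1..k}"])
        (use that zero in \<open>auto simp: q_less q_le\<close>)
    have "m = n 1 + (\<Sum>i=2..k. n i)"
      using k unfolding m_def by (simp add: sum.atLeast_Suc_atMost numeral_2_eq_2)
    then have "n 1 = nat c" using z 1 by simp
    then show ?thesis using z by (intro that(1)) auto
  next
    case 2
    define M where "M = real m"
    have M: "3 \<le> M" and cM: "real_of_int c = M + 1" using 2 c by (auto simp: M_def)
    have q2: "q 2 = (M + 1) / M" and q3: "q 3 = M / (M - 1)"
      and q4: "q 4 = (M + 1) * (M - 1) / (M\<^sup>2 - M - 1)"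
      and q5: "q 5 = (M\<^sup>2 - M - 1) / (M * (M - 2))"
      using M leg_ratio_2 leg_ratio_3 leg_ratio_4 leg_ratio_5 by (simp_all add: q_def cM)
    define N where "N = (\<Sum>i=3..k. n i)"
    have split: "(\<Sum>i=1..k. f i) = f 1 + f 2 + (\<Sum>i=3..k. f i)" for f :: "nat \<Rightarrow> 'b :: comm_monoid_add"
      using k by (simp add: sum.atLeast_Suc_atMost numeral_2_eq_2 numeral_3_eq_3 add.assoc)
    have mN: "m = n 1 + n 2 + N" unfolding m_def N_def by (rule split)
    have sumq: "(\<Sum>i=1..k. real (n i) * q i) = M + 1"
      using sum unfolding q_def cM .
    \<comment> \<open>The total excess over \<open>t\<close> of the legs with at least 3 vertices;
      \<open>t\<close> will be \<open>q 2\<close>, \<open>q 3\<close> and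
      \<open>q 5\<close>.\<close>
    have shifted: "(\<Sum>i=3..k. real (n i) * (q i - t)) =
        M + 1 - real (n 1) - real (n 2) * ((M + 1) / M) - real N * t" for t
      using sumq unfolding split q1 q2 sum_weighted_diff N_def[symmetric] by linarith
    have MN: "real N = M - real (n 1) - real (n 2)" using mN by (simp add: M_def)
    \<comment> \<open>Each pendant vertex lies \<open>1 / M\<close> below the overall average
      \<open>q 2\<close>, and the legs with at least 3 vertices must make up for it.\<close>
    have "(\<Sum>i=3..k. real (n i) * (q i - q 2)) = real (n 1) / M"
      unfolding shifted MN q2 using M by (simp add: field_simps)
    note excess2 = this
    show ?thesis
    proof (cases "n 1 = 0")
      case True
      have z: "n i = 0" if "i \<in> {3..k}" for i
        by (rule weight_eq_0_if_sum_weighted_eq_0[of n q "q 2" "{3..k}"])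
          (use that excess2 True in \<open>auto simp: q_less q_le\<close>)
      then have "N = 0" by (simp add: N_def)
      then have "n 2 = nat (c - 1)" using mN True 2 by simp
      moreover have "i = 1 \<or> i = 2 \<or> i \<in> {3..k}" if "i \<in> {1..k}" for i using that by auto
      ultimately show ?thesis using z True by (intro that(2)) fastforce
    next
      case False
      have N0: "0 < N"
        using excess2 False M unfolding N_def by (intro gr0I) auto
      have upper: "real (n 1) < real N * (M * (b - q 2))" if "\<And>i. q i < b" for b
      proof -
        have "(\<Sum>i=3..k. real (n i) * q i) < real N * b"
          using sum_weighted_less[OF less_imp_neq[OF N0, symmetric, unfolded N_def] that]
          unfolding N_def .
        then have "real (n 1) / M < real N * (b - q 2)"
          unfolding excess2[symmetric] sum_weighted_diff N_def[symmetric]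
          by (simp add: right_diff_distrib)
        then show ?thesis using M by (simp add: field_simps)
      qed
      have n12: "n 1 = 1 \<and> n 2 \<le> 1"
      \<comment> \<open>The coarse bound needs \<open>M\<close> at least 4. For \<open>m = 3\<close>
        the bound 2 gives \<open>n 1 < 2 * N\<close>, which is enough as
        \<open>n 1 + n 2 + N = 3\<close>.\<close>
      proof (cases "m = 3")
        case True
        then have "M * (2 - q 2) = 2" by (simp add: q2 M_def field_simps)
        then have "real (n 1) < real N * 2"
          using upper[of 2] leg_ratio_less_2[OF y] by (simp add: q_def)
        then have "n 1 < N * 2" by linarith
        then show ?thesis using mN True False by linarith
      next
        case m3: False
        then have M4: "4 \<le> M" using M by (simp add: M_def)
        have "M * (1 + 1 / M + 1 / (M * (M - 3)) - q 2) = 1 / (M - 3)"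
          using M4 by (simp add: q2 field_simps)
        then have "real (n 1) < real N * (1 / (M - 3))"
          using upper[of "1 + 1 / M + 1 / (M * (M - 3))"] leg_ratio_less_coarse[OF M4]
          by (simp add: q_def cM)
        \<comment> \<open>Equivalently \<open>n 1 * (M - 2) + n 2 < M\<close>: this excludes
          \<open>n 1\<close> at least 2, and for \<open>n 1 = 1\<close> it gives
          \<open>n 2 < 2\<close>.\<close>
        then have less: "real (n 1) * (M - 3) < M - real (n 1) - real (n 2)"
          using M4 by (simp add: MN field_simps)
        have "n 1 < 2"
        proof (rule ccontr)
          assume "\<not> n 1 < 2"
          then have "2 * (M - 2) \<le> real (n 1) * (M - 2)" using M4 by (intro mult_right_mono) auto
          then show False using less M4 by (simp add: algebra_simps)
        qed
        then have "n 1 = 1" using False by linarith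
        then show ?thesis using less by simp
      qed
      show ?thesis
      proof (cases "n 2 = 0")
        case True
        \<comment> \<open>The remaining \<open>M - 1\<close> legs have average \<open>q 3\<close>,
          the least ratio among them.\<close>
        have zero: "(\<Sum>i=3..k. real (n i) * (q i - q 3)) = 0"
          unfolding shifted MN q3 using n12 True M by (simp add: field_simps)
        have z: "n i = 0" if "i \<in> {4..k}" for i
          by (rule weight_eq_0_if_sum_weighted_eq_0[of n q "q 3" "{3..k}"])
            (use that zero in \<open>auto simp: q_less q_le\<close>)
        have "N = n 3 + (\<Sum>i=4..k. n i)"
          using k unfolding N_def by (simp add: sum.atLeast_Suc_atMost eval_nat_numeral)
        then have "n 3 = nat (c - 2)" using z mN n12 True 2 by simp
        moreover have "i = 1 \<or> i = 2 \<or> i = 3 \<or> i \<in> {4..k}" if "i \<in> {1..k}" for i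
          using that by auto
        ultimately show ?thesis using z n12 True by (intro that(3)) fastforce
      next
        case False
        then have n2: "n 2 = 1" using n12 by simp
        \<comment> \<open>The remaining \<open>M - 2\<close> legs have average \<open>q 5\<close>.
          Legs with 3 or 4 vertices lie below it, so they must be excluded before the argument of
          the previous case applies.\<close>
        have excess5: "(\<Sum>i=3..k. real (n i) * (q i - q 5)) = 0"
          unfolding shifted MN q5 using n12 n2 M
          by (simp add: field_simps) (simp add: algebra_simps power2_eq_square)
        have split34: "(\<Sum>i=3..k. f i) = f 3 + f 4 + (\<Sum>i=5..k. f i)"
          for f :: "nat \<Rightarrow> 'b :: comm_monoid_add"
          using k by (simp add: sum.atLeast_Suc_atMost eval_nat_numeral add.assoc)
        have n34: "n 3 = 0 \<and> n 4 = 0"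
        proof (rule ccontr)
          assume "\<not> (n 3 = 0 \<and> n 4 = 0)"
          then obtain a where a: "a \<in> {3..k}" "a \<le> 4" "0 < n a" using k by fastforce
          note D = square_minus_self_gt_1[OF M]
          have gap: "q 5 - q 4 = 1 / (M * (M - 2) * (M\<^sup>2 - M - 1))"
            unfolding q4 q5 using M D
            by (simp add: field_simps) (simp add: algebra_simps power2_eq_square power4_eq_xxxx)
          txt \<open>Legs with at least 6 vertices exceed \<open>q 5\<close> by so little that even \<open>N - 1\<close> of them cannot
            make up for a single leg with 3 or 4 vertices.\<close>
          have "\<exists>d\<ge>0. (\<forall>i. q i \<le> q 5 + d) \<and> real (N - 1) * d < q 5 - q 4"
          proof (cases "m = 3")
            case True
            \<comment> \<open>Here \<open>N = 1\<close>: there is no other leg to compensate, and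
              the bound 2 on all ratios suffices.\<close>
            have "q 5 \<le> 2" using leg_ratio_less_2[OF y, of 5] by (simp add: q_def)
            moreover have "q i \<le> 2" for i using leg_ratio_less_2[OF y, of i] by (simp add: q_def)
            moreover have "N - 1 = 0" using mN n12 n2 True by simp
            ultimately show ?thesis using q_less[of 4 5] by (intro exI[of _ "2 - q 5"]) auto
          next
            case False
            then have M4: "4 \<le> M" using M by (simp add: M_def)
            \<comment> \<open>With \<open>N - 1 = M - 3\<close> and \<open>d\<close> from the fine
              bound, this is the claim \<open>(N - 1) * d < q 5 - q 4\<close> after clearing
              denominators.\<close>
            have "(M - 3) * (M\<^sup>2 - M - 1) < M * (M - 2)\<^sup>2"
              using M4 by (simp add: algebra_simps power2_eq_square)
            then have "(M - 3) / (M\<^sup>2 * (M - 2) ^ 3) < 1 / (M * (M - 2) * (M\<^sup>2 - M - 1))"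
            proof -
              have "(M - 3) / (M\<^sup>2 * (M - 2) ^ 3) =
                  ((M - 3) * (M\<^sup>2 - M - 1)) / (M\<^sup>2 * (M - 2) ^ 3 * (M\<^sup>2 - M - 1))"
                using D by simp
              also have "\<dots> < (M * (M - 2)\<^sup>2) / (M\<^sup>2 * (M - 2) ^ 3 * (M\<^sup>2 - M - 1))"
                using \<open>(M - 3) * (M\<^sup>2 - M - 1) < M * (M - 2)\<^sup>2\<close> D M4
                by (intro divide_strict_right_mono) auto
              also have "\<dots> = 1 / (M * (M - 2) * (M\<^sup>2 - M - 1))"
                using D M4 by (simp add: divide_simps power2_eq_square power3_eq_cube)
              finally show ?thesis .
            qed
            moreover have "real (N - 1) = M - 3"
              using N0 MN n12 n2 by (simp add: of_nat_diff)
            moreover have "q i \<le> q 5 + 1 / (M\<^sup>2 * (M - 2) ^ 3)" for i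
              using leg_ratio_less_fine[OF M4, of i] by (simp add: q_def cM)
            ultimately show ?thesis
              using M4 by (intro exI[of _ "1 / (M\<^sup>2 * (M - 2) ^ 3)"]) (auto simp: gap)
          qed
          then obtain d where d: "0 \<le> d" "\<And>i. q i \<le> q 5 + d" "real (N - 1) * d < q 5 - q 4"
            by blast
          have rest: "N = n a + (\<Sum>i\<in>{3..k} - {a}. n i)"
            unfolding N_def using a by (intro sum.remove) auto
          \<comment> \<open>One leg of length \<open>a\<close> contributes at most
            \<open>q 4 - q 5\<close>, and the other \<open>N - 1\<close> legs at most
            \<open>d\<close> each, so the total would be negative.\<close>
          have "(\<Sum>i=3..k. real (n i) * (q i - q 5)) =
              real (n a) * (q a - q 5) + (\<Sum>i\<in>{3..k} - {a}. real (n i) * (q i - q 5))"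
            using a by (intro sum.remove) auto
          also have "(\<Sum>i\<in>{3..k} - {a}. real (n i) * (q i - q 5)) \<le> (\<Sum>i\<in>{3..k} - {a}. real (n i) * d)"
            using d(2) by (intro sum_mono mult_left_mono) (auto simp: algebra_simps)
          also have "\<dots> = real (N - n a) * d"
            using rest by (simp add: sum_distrib_right)
          also have "\<dots> \<le> real (N - 1) * d"
            using a d(1) by (intro mult_right_mono) auto
          also have "real (n a) * (q a - q 5) \<le> 1 * (q a - q 5)"
            using a q_le[of a 5] by (intro mult_right_mono_neg) auto
          also have "\<dots> \<le> q 4 - q 5" using a q_le[of a 4] by simp
          finally show False using d(3) excess5 by simp
        qed
        then have zero: "(\<Sum>i=5..k. real (n i) * (q i - q 5)) = 0"
          using excess5 unfolding split34 by simp
        have z: "n i = 0" if "i \<in> {6..k}" for i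
          by (rule weight_eq_0_if_sum_weighted_eq_0[of n q "q 5" "{5..k}"])
            (use that zero in \<open>auto simp: q_less q_le\<close>)
        have "N = n 5 + (\<Sum>i=6..k. n i)"
          using k n34 unfolding N_def split34 by (simp add: sum.atLeast_Suc_atMost eval_nat_numeral)
        then have "n 5 = nat (c - 3)" using z mN n12 n2 2 by simp
        moreover have "i = 1 \<or> i = 2 \<or> i = 3 \<or> i = 4 \<or> i = 5 \<or> i \<in> {6..k}" if "i \<in> {1..k}" for i
          using that by auto
        ultimately show ?thesis using z n12 n2 n34 by (intro that(4)) fastforce
      qed
    qed
  qed
qed

section \<open>Starlike trees with polynomial of form (I)\<close>

text \<open>Extension by 0 makes lists that differ in trailing zeros indistinguishable.\<close>

definition leg_count :: "nat list \<Rightarrow> nat \<Rightarrow> nat" where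
  "leg_count ns i = (if i \<in> {1..length ns} then ns ! (i - 1) else 0)"

text \<open>Vertices and arcs depend on the list only through \<open>leg_count\<close>, so the trees
  are equal and not merely isomorphic.\<close>

lemma starlike_tree_cong:
  assumes "leg_count ns = leg_count ns'"
  shows "starlike_tree ns = starlike_tree ns'"
proof -
  have legs: "1 \<le> i \<and> i \<le> length ms \<and> j < ms ! (i - 1) \<longleftrightarrow> j < leg_count ms i" for ms i j
    by (auto simp: leg_count_def)
  have legs': "1 \<le> i \<and> i \<le> length ms \<and> j < ms ! (i - 1) \<and> P \<longleftrightarrow> j < leg_count ms i \<and> P" for ms i j P
    by (auto simp: leg_count_def)
  show ?thesis
    by (simp only: starlike_tree_def starlike_edges_def legs legs' assms)
qed

definition form_I :: "nat \<Rightarrow> nat \<Rightarrow> nat \<Rightarrow> nat \<Rightarrow> nat \<Rightarrow> int \<Rightarrow> int poly" where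
  "form_I t1 t2 t3 t4 t5 c =
     [:0, 1:] ^ t1 * [:-1, 0, 1:] ^ t2 * [:-2, 0, 1:] ^ t3 *
     ([:-1, -1, 1:] * [:-1, 1, 1:]) ^ t4 * [:-3, 0, 1:] ^ t5 * [:-c, 0, 1:]"

lemma poly_form_I:
  fixes x :: real
  shows "poly (map_poly of_int (form_I t1 t2 t3 t4 t5 c)) x =
    x ^ t1 * (x\<^sup>2 - 1) ^ t2 * (x\<^sup>2 - 2) ^ t3 * ((x\<^sup>2 - x - 1) * (x\<^sup>2 + x - 1)) ^ t4 *
    (x\<^sup>2 - 3) ^ t5 * (x\<^sup>2 - c)"
  unfolding form_I_def poly_map_of_int by simp

text \<open>Beyond \<open>sqrt c\<close>, which is at least 2, every factor is positive, so no
  larger root exists.\<close>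

lemma lambda1_form_I:
  assumes "graph_char_poly G = form_I t1 t2 t3 t4 t5 c" "4 \<le> c"
  shows "lambda1 G = sqrt c"
  unfolding lambda1_def
proof (rule Max_eqI[OF finite_graph_eigenvalues])
  have c: "4 \<le> real_of_int c" using assms(2) by simp
  then show "sqrt c \<in> graph_eigenvalues G"
    by (simp add: graph_eigenvalues_eq_roots assms(1) poly_form_I)
  fix x assume x: "x \<in> graph_eigenvalues G"
  show "x \<le> sqrt c"
  proof (rule ccontr)
    assume "\<not> x \<le> sqrt c"
    then have less: "sqrt c < x" by simp
    then have sq: "c < x\<^sup>2" using c power_strict_mono[OF less, of 2] by simp
    have "2 \<le> sqrt c" using c by (simp add: real_le_rsqrt)
    then have "2 < x" using less by simp
    then have "2 * x < x\<^sup>2" by (simp add: power2_eq_square)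
    then have "x\<^sup>2 - x - 1 > 0" "x\<^sup>2 + x - 1 > 0" using \<open>2 < x\<close> by linarith+
    then have "poly (map_poly of_int (form_I t1 t2 t3 t4 t5 c)) x > 0"
      unfolding poly_form_I using sq c \<open>2 < x\<close> by (intro mult_pos_pos zero_less_power) auto
    then show False using x by (simp add: graph_eigenvalues_eq_roots assms(1))
  qed
qed

text \<open>At the root \<open>sqrt c\<close> all path polynomials are positive, so the pivot of the
  centre vanishes. This is the equation that \<open>legs_classification\<close> solves.\<close>

lemma starlike_form_I_cases:
  assumes f: "graph_char_poly (starlike_tree ns) = form_I t1 t2 t3 t4 t5 c" and c: "4 \<le> c"
  obtains n where "1 \<le> n" "starlike_tree ns = starlike_tree [1, 1, 0, 0, n]"
  | n where "2 \<le> n" "starlike_tree ns = starlike_tree [1, 0, n]"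
  | n where "3 \<le> n" "starlike_tree ns = starlike_tree [0, n]"
  | n where "4 \<le> n" "starlike_tree ns = starlike_tree [n]"
proof -
  define x where "x = sqrt c"
  \<comment> \<open>Large enough for \<open>ns\<close> and for each of the four target lists, which
    have length at most 5.\<close>
  define k where "k = length ns + 5"
  have x2: "x\<^sup>2 = c" using c by (simp add: x_def)
  have x: "2 \<le> x" using c by (simp add: x_def real_le_rsqrt)
  have "poly (map_poly of_int (graph_char_poly (starlike_tree ns))) x = 0"
    unfolding f poly_form_I x2 by simp
  moreover have "(\<Prod>i=1..length ns. path_poly i x ^ (ns ! (i - 1))) > 0"
    using path_poly_pos[OF x] by (intro prod_pos) simp
  ultimately have "x - (\<Sum>i=1..length ns. real (ns ! (i - 1)) * (path_poly (i - 1) x / path_poly i x)) = 0"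
    unfolding poly_graph_char_poly_starlike_tree[OF x] by (simp only: mult_eq_0_iff) (metis less_irrefl)
  then have "x = (\<Sum>i=1..length ns. real (ns ! (i - 1)) * (path_poly (i - 1) x / path_poly i x))"
    by (simp only: right_minus_eq)
  \<comment> \<open>Multiplying by \<open>x\<close> turns the quotients of path polynomials into leg
    ratios at \<open>c\<close> and the left side into the integer \<open>c\<close>.\<close>
  then have "x * x = x * \<dots>" by simp
  also have "\<dots> = (\<Sum>i=1..length ns. real (leg_count ns i) * leg_ratio c i)"
    unfolding sum_distrib_left
  proof (rule sum.cong[OF refl])
    fix i assume i: "i \<in> {1..length ns}"
    then obtain j where "i = Suc j" by (cases i) auto
    then show "x * (real (ns ! (i - 1)) * (path_poly (i - 1) x / path_poly i x)) =
        real (leg_count ns i) * leg_ratio c i"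
      using i leg_ratio_path_poly[OF x, of j] by (simp add: x2 leg_count_def)
  qed
  also have "\<dots> = (\<Sum>i=1..k. real (leg_count ns i) * leg_ratio c i)"
    by (intro sum.mono_neutral_left) (auto simp: k_def leg_count_def)
  finally have sum: "(\<Sum>i=1..k. real (leg_count ns i) * leg_ratio c i) = c"
    using x2 by (simp add: power2_eq_square)
  have outside: "leg_count ns i = 0" if "i \<notin> {1..k}" for i
    using that by (auto simp: leg_count_def k_def)
  have cong: "starlike_tree ns = starlike_tree ms"
    if "\<And>i. i \<in> {1..k} \<Longrightarrow> leg_count ns i = leg_count ms i" "length ms \<le> 5" for ms
  proof (intro starlike_tree_cong ext)
    fix i
    show "leg_count ns i = leg_count ms i"
      using that outside[of i] by (cases "i \<in> {1..k}") (auto simp: leg_count_def k_def)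
  qed
  have "5 \<le> k" by (simp add: k_def)
  from c this sum show ?thesis
  proof (cases rule: legs_classification)
    case 1
    then have "starlike_tree ns = starlike_tree [nat c]"
      by (intro cong) (auto simp: leg_count_def)
    then show ?thesis using c by (intro that(4)[of "nat c"]) auto
  next
    case 2
    then have "starlike_tree ns = starlike_tree [0, nat (c - 1)]"
      by (intro cong) (auto simp: leg_count_def nth_Cons')
    then show ?thesis using c by (intro that(3)[of "nat (c - 1)"]) auto
  next
    case 3
    then have "starlike_tree ns = starlike_tree [1, 0, nat (c - 2)]"
      by (intro cong) (auto simp: leg_count_def nth_Cons')
    then show ?thesis using c by (intro that(2)[of "nat (c - 2)"]) auto
  next
    case 4
    then have "starlike_tree ns = starlike_tree [1, 1, 0, 0, nat (c - 3)]"
      by (intro cong) (auto simp: leg_count_def nth_Cons')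
    then show ?thesis using c by (intro that(1)[of "nat (c - 3)"]) auto
  qed
qed

theorem theorem4p6:
  fixes T :: "'a pair_pre_digraph"
  assumes "pair_graph T"
    and "connected (with_proj T)"
    and "\<exists>ns. is_starlike T ns"
    and "quadratic_graph T"
    and "has_proper_induced_K13 T"
  shows
    "((\<exists>(t1::nat) (t2::nat) (t3::nat) (t4::nat) (t5::nat) (c::int).
         c \<ge> 4 \<and>
         graph_char_poly T =
           [:0, 1:] ^ t1 * [:-1, 0, 1:] ^ t2 * [:-2, 0, 1:] ^ t3 *
           ([:-1, -1, 1:] * [:-1, 1, 1:]) ^ t4 * [:-3, 0, 1:] ^ t5 * [:-c, 0, 1:] \<and>
         poly (map_poly real_of_int [:-c, 0, 1:]) (lambda1 T) = 0)
      \<longleftrightarrow>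
      (\<exists>n5\<ge>1. is_starlike T [1, 1, 0, 0, n5]) \<or>
      (\<exists>n3\<ge>2. is_starlike T [1, 0, n3]) \<or>
      (\<exists>n2\<ge>3. is_starlike T [0, n2]) \<or>
      (\<exists>n1\<ge>4. is_starlike T [n1])) \<and>
     (\<forall>n5\<ge>1. is_starlike T [1, 1, 0, 0, n5] \<longrightarrow>
        graph_char_poly T =
          [:0, 1:] ^ n5 * [:-1, 0, 1:] ^ n5 * [:-1, -1, 1:] * [:-1, 1, 1:] *
          [:-3, 0, 1:] ^ (n5 - 1) * [:- (int n5 + 3), 0, 1:]) \<and>
     (\<forall>n3\<ge>2. is_starlike T [1, 0, n3] \<longrightarrow>
        graph_char_poly T =
          [:0, 1:] ^ n3 * [:-1, 0, 1:] * [:-2, 0, 1:] ^ (n3 - 1) *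
          [:- (int n3 + 2), 0, 1:]) \<and>
     (\<forall>n2\<ge>3. is_starlike T [0, n2] \<longrightarrow>
        graph_char_poly T =
          [:0, 1:] * [:-1, 0, 1:] ^ (n2 - 1) * [:- (int n2 + 1), 0, 1:]) \<and>
     (\<forall>n1\<ge>4. is_starlike T [n1] \<longrightarrow>
        graph_char_poly T = [:0, 1:] ^ (n1 - 1) * [:- int n1, 0, 1:])"
proof -
  have fin: "finite (pverts T)"
    using assms(1) by (simp add: pair_graph_def pair_fin_digraph_def pair_fin_digraph_axioms_def
      pair_digraph_def)
  have iso: "graph_char_poly T = graph_char_poly (starlike_tree ns)" if "is_starlike T ns" for ns
    using graph_char_poly_iso[OF fin] that by (simp add: is_starlike_def)
  have f1: "graph_char_poly T =
      [:0, 1:] ^ n * [:-1, 0, 1:] ^ n * [:-1, -1, 1:] * [:-1, 1, 1:] *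
      [:-3, 0, 1:] ^ (n - 1) * [:- (int n + 3), 0, 1:]"
    if "1 \<le> n" "is_starlike T [1, 1, 0, 0, n]" for n
    unfolding iso[OF that(2)] using that(1) by (rule graph_char_poly_starlike_1_1_0_0_n)
  have f2: "graph_char_poly T =
      [:0, 1:] ^ n * [:-1, 0, 1:] * [:-2, 0, 1:] ^ (n - 1) * [:- (int n + 2), 0, 1:]"
    if "2 \<le> n" "is_starlike T [1, 0, n]" for n
    unfolding iso[OF that(2)] using that(1) by (intro graph_char_poly_starlike_1_0_n) simp
  have f3: "graph_char_poly T =
      [:0, 1:] * [:-1, 0, 1:] ^ (n - 1) * [:- (int n + 1), 0, 1:]"
    if "3 \<le> n" "is_starlike T [0, n]" for n
    unfolding iso[OF that(2)] using that(1) by (intro graph_char_poly_starlike_0_n) simp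
  have f4: "graph_char_poly T = [:0, 1:] ^ (n - 1) * [:- int n, 0, 1:]"
    if "4 \<le> n" "is_starlike T [n]" for n
    unfolding iso[OF that(2)] using that(1) by (intro graph_char_poly_star) simp
  let ?I = "\<exists>t1 t2 t3 t4 t5 c. 4 \<le> c \<and> graph_char_poly T = form_I t1 t2 t3 t4 t5 c \<and>
    poly (map_poly real_of_int [:-c, 0, 1:]) (lambda1 T) = 0"
  let ?F = "(\<exists>n5\<ge>1. is_starlike T [1, 1, 0, 0, n5]) \<or> (\<exists>n3\<ge>2. is_starlike T [1, 0, n3]) \<or>
    (\<exists>n2\<ge>3. is_starlike T [0, n2]) \<or> (\<exists>n1\<ge>4. is_starlike T [n1])"
  \<comment> \<open>The condition on \<open>lambda1\<close> follows from the factorization, so only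
    the exponents and \<open>c\<close> remain to be exhibited.\<close>
  have I: ?I if "graph_char_poly T = form_I t1 t2 t3 t4 t5 c" "4 \<le> c" for t1 t2 t3 t4 t5 c
  proof -
    have "poly (map_poly real_of_int [:-c, 0, 1:]) (lambda1 T) = 0"
      using that(2) by (simp add: lambda1_form_I[OF that])
    then show ?thesis using that by blast
  qed
  have "?I \<longleftrightarrow> ?F"
  proof
    assume ?I
    then obtain t1 t2 t3 t4 t5 c where f: "graph_char_poly T = form_I t1 t2 t3 t4 t5 c" and c: "4 \<le> c"
      by blast
    obtain ns where ns: "is_starlike T ns" using assms(3) by blast
    have "graph_char_poly (starlike_tree ns) = form_I t1 t2 t3 t4 t5 c"
      using f iso[OF ns] by simp
    then show ?F
      using c by (cases rule: starlike_form_I_cases) (use ns in \<open>auto simp: is_starlike_def\<close>)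
  next
    assume ?F
    then consider n where "1 \<le> n" "is_starlike T [1, 1, 0, 0, n]"
      | n where "2 \<le> n" "is_starlike T [1, 0, n]"
      | n where "3 \<le> n" "is_starlike T [0, n]"
      | n where "4 \<le> n" "is_starlike T [n]"
      by blast
    then show ?I
    proof cases
      case (1 n)
      have "graph_char_poly T = form_I n n 0 1 (n - 1) (int n + 3)"
        unfolding f1[OF 1] form_I_def
        by (simp only: power_0 power_one_right mult_1_left mult_1_right mult.assoc)
      then show ?I by (rule I) (use 1 in simp)
    next
      case (2 n)
      have "graph_char_poly T = form_I n 1 (n - 1) 0 0 (int n + 2)"
        unfolding f2[OF 2] form_I_def
        by (simp only: power_0 power_one_right mult_1_left mult_1_right mult.assoc)
      then show ?I by (rule I) (use 2 in simp)
    next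
      case (3 n)
      have "graph_char_poly T = form_I 1 (n - 1) 0 0 0 (int n + 1)"
        unfolding f3[OF 3] form_I_def
        by (simp only: power_0 power_one_right mult_1_left mult_1_right mult.assoc)
      then show ?I by (rule I) (use 3 in simp)
    next
      case (4 n)
      have "graph_char_poly T = form_I (n - 1) 0 0 0 0 (int n)"
        unfolding f4[OF 4] form_I_def
        by (simp only: power_0 power_one_right mult_1_left mult_1_right mult.assoc)
      then show ?I by (rule I) (use 4 in simp)
    qed
  qed
  then show ?thesis
    unfolding form_I_def using f1 f2 f3 f4 by blast
qed

end
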